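(* Let $(\Omega,\Sigma)$ be a standard Borel space and let $Q=BC\cap AC_\infty$. Let $(\nu_k)_k$ be a uniformly BC integrable sequence in $Q$ that $\|\cdot\|_\infty$-converges to a game $\nu\in AC_\infty$. Then $\nu\in Q$.
   Context: A game is a set function $\nu:\Sigma\to\mathbb{R}$ with $\nu(\emptyset)=0$; it is monotone if $\nu(A)\le\nu(B)$ whenever $A\subseteq B$. $NA^+$ is the set of nonnegative (finite) nonatomic countably additive measures on $\Sigma$. $BV$ is the space of games with $\sup\sum_i|\nu(S_i)-\nu(S_{i-1})|<\infty$ over all finite chains $\emptyset=S_0\subset\dots\subset S_m=\Omega$ in $\Sigma$. For games write $\nu\preceq\eta$ if $\eta-\nu$ is monotone. $AC_\infty$ (Lipschitz games) is the space of $\nu\in BV$ such that $-\mu\preceq\nu\preceq\mu$ for some $\mu\in NA^+$; it is a Banach space with the norm $\|\nu\|_\infty=\inf\{\mu(\Omega):\mu\in NA^+,\ -\mu\preceq\nu\preceq\mu\}$. For $E\in\Sigma$, $\Pi(E)$ is the set of finite partitions of $E$ into disjoint elements of $\Sigma$. For $\lambda\in NA^+$ and $D\in\Pi(E)$ put $\delta_\lambda(D)=\max\{\lambda(I):I\in D\}$. A game $\nu$ is $\delta_\lambda$-BC (Burkill-Cesari) integrable if for every $E\in\Sigma$ the finite limit $\partial^+_{\emptyset}(\nu,E):=\lim_{\delta_\lambda(D)\to0,\,D\in\Pi(E)}\sum_{I\in D}\nu(I)$ exists, i.e. for every $\varepsilon>0$ there is $\delta>0$ such that $|\sum_{I\in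 D}\nu(I)-\partial^+_{\emptyset}(\nu,E)|<\varepsilon$ for all $D\in\Pi(E)$ with $\delta_\lambda(D)<\delta$. $BC$ is the space of games that are $\delta_\lambda$-BC integrable for some $\lambda\in NA^+$; the integral is known not to depend on the choice of such $\lambda$. Given a sequence $(\nu_k)_k$ in $BC$, with $\lambda_k\in NA^+$ such that $\nu_k$ is $\delta_{\lambda_k}$-BC integrable, put $\lambda=\sum_{n=1}^\infty\lambda_n/2^n$, where the $\lambda_n$ are scaled so that the series converges and $\lambda\in NA^+$; each $\nu_k$ is then $\delta_\lambda$-BC integrable. The sequence $(\nu_k)_k$ is uniformly BC integrable if for every $F\in\Sigma$ and every $\varepsilon>0$ there exists $\delta>0$ such that for every $D\in\Pi(F)$ with $\delta_\lambda(D)<\delta$ and every $k\in\mathbb{N}$, $\left|\sum_{I\in D}\nu_k(I)-\partial^+_{\emptyset}(\nu_k,F)\right|<\varepsilon$. *)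

theory Defs
  imports "HOL-Analysis.Analysis"
begin

text \<open>
  The measurable space \<open>(\<Omega>, \<Sigma>)\<close> is given by \<open>space M\<close> and \<open>sets M\<close> of some \<open>M :: 'a measure\<close>, whose
  measure part is never used. Set functions on \<open>\<Sigma>\<close> are represented by total functions
  \<open>'a set \<Rightarrow> real\<close>; no notion below depends on their values outside \<open>sets M\<close>.
\<close>

definition standard_borel_space :: "'a measure \<Rightarrow> bool" where
  "standard_borel_space M \<longleftrightarrow>
     (\<exists>X. topspace X = space M \<and> completely_metrizable_space X \<and> second_countable X \<and>
          sets M = sigma_sets (space M) {U. openin X U})"

definition game :: "('a set \<Rightarrow> real) \<Rightarrow> bool" where
  "game \<nu> \<longleftrightarrow> \<nu> {} = 0"

definition nonatomic :: "'a measure \<Rightarrow> bool" where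
  "nonatomic \<mu> \<longleftrightarrow>
     \<not> (\<exists>A\<in>sets \<mu>. measure \<mu> A > 0 \<and>
          (\<forall>B\<in>sets \<mu>. B \<subseteq> A \<longrightarrow> measure \<mu> B = 0 \<or> measure \<mu> B = measure \<mu> A))"

definition NA_plus :: "'a measure \<Rightarrow> 'a measure set" where
  "NA_plus M = {\<mu>. sets \<mu> = sets M \<and> finite_measure \<mu> \<and> nonatomic \<mu>}"

definition BV :: "'a measure \<Rightarrow> ('a set \<Rightarrow> real) set" where
  "BV M = {\<nu>. game \<nu> \<and>
     bdd_above {\<Sum>i<m. \<bar>\<nu> (S (Suc i)) - \<nu> (S i)\<bar> | (S :: nat \<Rightarrow> 'a set) m.
       S 0 = {} \<and> S m = space M \<and> (\<forall>i\<le>m. S i \<in> sets M) \<and> (\<forall>i<m. S i \<subseteq> S (Suc i))}}"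

definition game_le :: "'a measure \<Rightarrow> ('a set \<Rightarrow> real) \<Rightarrow> ('a set \<Rightarrow> real) \<Rightarrow> bool" where
  "game_le M \<nu> \<eta> \<longleftrightarrow> mono_on (sets M) (\<lambda>A. \<eta> A - \<nu> A)"

definition lipschitz_bounds :: "'a measure \<Rightarrow> ('a set \<Rightarrow> real) \<Rightarrow> 'a measure set" where
  "lipschitz_bounds M \<nu> =
     {\<mu> \<in> NA_plus M. game_le M (\<lambda>A. - measure \<mu> A) \<nu> \<and> game_le M \<nu> (measure \<mu>)}"

definition AC_inf :: "'a measure \<Rightarrow> ('a set \<Rightarrow> real) set" where
  "AC_inf M = {\<nu> \<in> BV M. lipschitz_bounds M \<nu> \<noteq> {}}"

text \<open>The infimum ranges over a nonempty set precisely when a bound exists, in particular on \<open>AC_inf M\<close>.\<close>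

definition norm_inf :: "'a measure \<Rightarrow> ('a set \<Rightarrow> real) \<Rightarrow> real" where
  "norm_inf M \<nu> = Inf {measure \<mu> (space M) | \<mu>. \<mu> \<in> lipschitz_bounds M \<nu>}"

text \<open>
  Blocks are nonempty by the convention of \<^const>\<open>partition_on\<close>. Admitting an empty block would change
  neither the sums \<open>\<Sum>I\<in>D. \<nu> I\<close> of a game nor the mesh.
\<close>

definition msble_partitions :: "'a measure \<Rightarrow> 'a set \<Rightarrow> 'a set set set" where
  "msble_partitions M E = {D. finite D \<and> D \<subseteq> sets M \<and> partition_on E D}"

text \<open>The inserted 0 only matters for the empty partition of \<open>{}\<close>, whose mesh is thereby 0.\<close>

definition mesh :: "'a measure \<Rightarrow> 'a set set \<Rightarrow> real" where
  "mesh \<rho> D = Max (insert 0 (measure \<rho> ` D))"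

definition has_BC_integral ::
  "'a measure \<Rightarrow> 'a measure \<Rightarrow> ('a set \<Rightarrow> real) \<Rightarrow> 'a set \<Rightarrow> real \<Rightarrow> bool" where
  "has_BC_integral M \<rho> \<nu> E L \<longleftrightarrow>
     (\<forall>\<epsilon>>0. \<exists>\<delta>>0. \<forall>D\<in>msble_partitions M E. mesh \<rho> D < \<delta> \<longrightarrow> \<bar>(\<Sum>I\<in>D. \<nu> I) - L\<bar> < \<epsilon>)"

definition BC_integrable_wrt :: "'a measure \<Rightarrow> 'a measure \<Rightarrow> ('a set \<Rightarrow> real) \<Rightarrow> bool" where
  "BC_integrable_wrt M \<rho> \<nu> \<longleftrightarrow> (\<forall>E\<in>sets M. \<exists>L. has_BC_integral M \<rho> \<nu> E L)"

text \<open>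
  The integral is formed with respect to an explicit \<open>\<rho>\<close>. Its value is the same for every
  \<open>\<rho> \<in> NA_plus M\<close> with \<open>BC_integrable_wrt M \<rho> \<nu>\<close>.
\<close>

definition BC_integral :: "'a measure \<Rightarrow> 'a measure \<Rightarrow> ('a set \<Rightarrow> real) \<Rightarrow> 'a set \<Rightarrow> real" where
  "BC_integral M \<rho> \<nu> E = (THE L. has_BC_integral M \<rho> \<nu> E L)"

definition BC :: "'a measure \<Rightarrow> ('a set \<Rightarrow> real) set" where
  "BC M = {\<nu>. game \<nu> \<and> (\<exists>\<rho>\<in>NA_plus M. BC_integrable_wrt M \<rho> \<nu>)}"

text \<open>
  \<open>\<rho>s k\<close> is the already scaled control measure of \<open>\<nu> k\<close>, and \<open>\<rho>\<close> is the measure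
  \<open>\<Sum>k. \<rho>s k / 2 ^ (k + 1)\<close>, with indices starting at 0. The family \<open>\<rho>s\<close> is not unique; as uniform
  integrability is used as a hypothesis, it is required for some choice of \<open>\<rho>s\<close> only.
\<close>

definition uniformly_BC_integrable :: "'a measure \<Rightarrow> (nat \<Rightarrow> 'a set \<Rightarrow> real) \<Rightarrow> bool" where
  "uniformly_BC_integrable M \<nu> \<longleftrightarrow>
     (\<exists>\<rho>s \<rho>. (\<forall>k. \<rho>s k \<in> NA_plus M \<and> BC_integrable_wrt M (\<rho>s k) (\<nu> k)) \<and>
        \<rho> \<in> NA_plus M \<and>
        (\<forall>A\<in>sets M. (\<lambda>k. measure (\<rho>s k) A / 2 ^ Suc k) sums measure \<rho> A) \<and>
        (\<forall>F\<in>sets M. \<forall>\<epsilon>>0. \<exists>\<delta>>0. \<forall>D\<in>msble_partitions M F. mesh \<rho> D < \<delta> \<longrightarrow>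
           (\<forall>k. \<bar>(\<Sum>I\<in>D. \<nu> k I) - BC_integral M \<rho> (\<nu> k) F\<bar> < \<epsilon>)))"

definition Q :: "'a measure \<Rightarrow> ('a set \<Rightarrow> real) set" where
  "Q M = BC M \<inter> AC_inf M"

end

theory Submission
  imports Defs
begin

text \<open>
  The norm dominates \<open>\<bar>\<Sum>I\<in>D. \<nu> I\<bar>\<close> for every partition \<open>D\<close>, since a Lipschitz bound \<open>\<mu>\<close> satisfies
  \<open>\<bar>\<nu> I\<bar> \<le> \<mu> I\<close>. Hence the sums of \<open>\<nu>s k\<close> over partitions are uniformly close to those of \<open>\<nu>\<close> when
  \<open>k\<close> is large, and the Cauchy criterion for the mesh of the common control measure passes to the
  limit.
\<close>

text \<open>Series in \<open>ennreal\<close> add termwise, so the pointwise sum is countably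
  additive and \<open>measure_of\<close> turns it into a measure. Finiteness of both summands is
  what carries the equation from \<open>emeasure\<close> to the real-valued
  \<open>measure\<close>.\<close>

lemma sum_measure_exists:
  assumes "finite_measure \<mu>" "finite_measure \<eta>" "sets \<mu> = sets \<eta>"
  obtains \<theta> where "sets \<theta> = sets \<mu>" "finite_measure \<theta>"
    "\<And>A. A \<in> sets \<mu> \<Longrightarrow> measure \<theta> A = measure \<mu> A + measure \<eta> A"
proof -
  interpret a: finite_measure \<mu> by fact
  interpret b: finite_measure \<eta> by fact
  define \<theta> where
    "\<theta> = measure_of (space \<mu>) (sets \<mu>) (\<lambda>A. emeasure \<mu> A + emeasure \<eta> A)"
  have sets: "sets \<theta> = sets \<mu>" and space: "space \<theta> = space \<mu>"
    by (simp_all add: \<theta>_def)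
  have em: "emeasure \<theta> A = emeasure \<mu> A + emeasure \<eta> A" if "A \<in> sets \<mu>" for A
  proof (rule emeasure_measure_of[OF \<theta>_def])
    show "sets \<mu> \<subseteq> Pow (space \<mu>)" by (rule sets.space_closed)
    show "positive (sets \<theta>) (\<lambda>A. emeasure \<mu> A + emeasure \<eta> A)"
      by (simp add: positive_def)
    show "countably_additive (sets \<theta>) (\<lambda>A. emeasure \<mu> A + emeasure \<eta> A)"
    proof (rule countably_additiveI)
      fix A :: "nat \<Rightarrow> _"
      assume A: "range A \<subseteq> sets \<theta>" "disjoint_family A"
      then show "(\<Sum>i. emeasure \<mu> (A i) + emeasure \<eta> (A i))
          = emeasure \<mu> (\<Union>i. A i) + emeasure \<eta> (\<Union>i. A i)"
        using sets assms(3)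
        by (simp add: suminf_add[symmetric] suminf_emeasure)
    qed
    show "A \<in> sets \<theta>" using that sets by simp
  qed
  have "finite_measure \<theta>"
    using a.emeasure_finite b.emeasure_finite
    by (intro finite_measureI) (simp add: space em)
  moreover have "measure \<theta> A = measure \<mu> A + measure \<eta> A" if "A \<in> sets \<mu>" for A
    unfolding measure_def em[OF that]
    by (rule enn2real_plus) (simp_all add: less_top[symmetric])
  ultimately show thesis using that sets by blast
qed

text \<open>This makes \<open>NA_plus M\<close> closed under addition, so that Lipschitz bounds of
  two games can be combined into one for their difference.\<close>

lemma NA_plus_add:
  assumes "\<mu> \<in> NA_plus M" "\<eta> \<in> NA_plus M"
  obtains \<theta> where "\<theta> \<in> NA_plus M"
    "\<And>A. A \<in> sets M \<Longrightarrow> measure \<theta> A = measure \<mu> A + measure \<eta> A"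
proof -
  from assms have s: "sets \<mu> = sets M" "sets \<eta> = sets M"
    and f: "finite_measure \<mu>" "finite_measure \<eta>"
    and n: "nonatomic \<mu>" "nonatomic \<eta>"
    by (auto simp: NA_plus_def)
  obtain \<theta> where t: "sets \<theta> = sets M" "finite_measure \<theta>"
    "\<And>A. A \<in> sets M \<Longrightarrow> measure \<theta> A = measure \<mu> A + measure \<eta> A"
    using sum_measure_exists[OF f] s by metis
  interpret a: finite_measure \<mu> by fact
  interpret b: finite_measure \<eta> by fact
  \<comment> \<open>An atom of the sum is an atom of each summand that does not vanish on it.\<close>
  have "nonatomic \<theta>"
    unfolding nonatomic_def
  proof
    assume "\<exists>A\<in>sets \<theta>. measure \<theta> A > 0 \<and>
      (\<forall>B\<in>sets \<theta>. B \<subseteq> A \<longrightarrow> measure \<theta> B = 0 \<or> measure \<theta> B = measure \<theta> A)"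
    then obtain A where A: "A \<in> sets M" "measure \<mu> A + measure \<eta> A > 0"
      and dich: "\<And>B. B \<in> sets M \<Longrightarrow> B \<subseteq> A \<Longrightarrow> measure \<mu> B + measure \<eta> B = 0 \<or>
        measure \<mu> B + measure \<eta> B = measure \<mu> A + measure \<eta> A"
      by (auto simp: t)
    \<comment> \<open>If the sum vanishes on \<open>B\<close>, both nonnegative terms do; if it has
      the same value on \<open>B\<close> as on \<open>A\<close>, the two inequalities given by
      monotonicity are equalities.\<close>
    have "(measure \<mu> B = 0 \<or> measure \<mu> B = measure \<mu> A) \<and>
        (measure \<eta> B = 0 \<or> measure \<eta> B = measure \<eta> A)" if "B \<in> sets M" "B \<subseteq> A" for B
    proof -
      have "measure \<mu> B \<le> measure \<mu> A" "measure \<eta> B \<le> measure \<eta> A"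
        using that A s by (auto intro!: a.finite_measure_mono b.finite_measure_mono)
      moreover have "measure \<mu> B \<ge> 0" "measure \<eta> B \<ge> 0" by simp_all
      ultimately show ?thesis using dich[OF that] by linarith
    qed
    moreover have "measure \<mu> A > 0 \<or> measure \<eta> A > 0"
      using A(2) measure_nonneg[of \<mu> A] measure_nonneg[of \<eta> A] by linarith
    ultimately show False
      using n A(1) unfolding nonatomic_def s by blast
  qed
  with t that show thesis by (auto simp: NA_plus_def)
qed

text \<open>The sum of a bound for \<nu> and a bound for \<eta> bounds the difference. Consequently
  the infimum defining \<open>norm_inf\<close> of the difference is taken over a nonempty
  set.\<close>

lemma lipschitz_bounds_diff_nonempty:
  assumes "lipschitz_bounds M \<nu> \<noteq> {}" "lipschitz_bounds M \<eta> \<noteq> {}"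
  shows "lipschitz_bounds M (\<lambda>A. \<nu> A - \<eta> A) \<noteq> {}"
proof -
  obtain \<mu>1 where 1: "\<mu>1 \<in> NA_plus M"
    "game_le M (\<lambda>A. - measure \<mu>1 A) \<nu>" "game_le M \<nu> (measure \<mu>1)"
    using assms(1) by (auto simp: lipschitz_bounds_def)
  obtain \<mu>2 where 2: "\<mu>2 \<in> NA_plus M"
    "game_le M (\<lambda>A. - measure \<mu>2 A) \<eta>" "game_le M \<eta> (measure \<mu>2)"
    using assms(2) by (auto simp: lipschitz_bounds_def)
  obtain \<theta> where t: "\<theta> \<in> NA_plus M"
    "\<And>A. A \<in> sets M \<Longrightarrow> measure \<theta> A = measure \<mu>1 A + measure \<mu>2 A"
    using NA_plus_add[OF 1(1) 2(1)] by metis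
  \<comment> \<open>Subtracting \<eta> exchanges the roles of its two bounds: the lower bound of the
    difference pairs the lower bound of \<nu> with the upper bound of \<eta>.\<close>
  have "game_le M (\<lambda>A. - measure \<theta> A) (\<lambda>A. \<nu> A - \<eta> A)"
    unfolding game_le_def
  proof (rule mono_onI)
    fix A B assume AB: "A \<in> sets M" "B \<in> sets M" "A \<subseteq> B"
    show "\<nu> A - \<eta> A - - measure \<theta> A \<le> \<nu> B - \<eta> B - - measure \<theta> B"
      using mono_onD[OF 1(2)[unfolded game_le_def] AB] mono_onD[OF 2(3)[unfolded game_le_def] AB]
      unfolding t(2)[OF AB(1)] t(2)[OF AB(2)] by linarith
  qed
  moreover have "game_le M (\<lambda>A. \<nu> A - \<eta> A) (measure \<theta>)"
    unfolding game_le_def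
  proof (rule mono_onI)
    fix A B assume AB: "A \<in> sets M" "B \<in> sets M" "A \<subseteq> B"
    show "measure \<theta> A - (\<nu> A - \<eta> A) \<le> measure \<theta> B - (\<nu> B - \<eta> B)"
      using mono_onD[OF 1(3)[unfolded game_le_def] AB] mono_onD[OF 2(2)[unfolded game_le_def] AB]
      unfolding t(2)[OF AB(1)] t(2)[OF AB(2)] by linarith
  qed
  ultimately show ?thesis using t(1) by (auto simp: lipschitz_bounds_def)
qed

text \<open>Compare the values at \<open>{}\<close> and \<open>A\<close> of the monotone functions
  \<nu> + \<mu> and \<mu> - \<nu>; both vanish at \<open>{}\<close>.\<close>

lemma abs_le_lipschitz_bound:
  assumes "game \<nu>" "\<mu> \<in> lipschitz_bounds M \<nu>" "A \<in> sets M"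
  shows "\<bar>\<nu> A\<bar> \<le> measure \<mu> A"
proof -
  have "game_le M (\<lambda>A. - measure \<mu> A) \<nu>" "game_le M \<nu> (measure \<mu>)"
    using assms(2) by (auto simp: lipschitz_bounds_def)
  from this[unfolded game_le_def, THEN mono_onD, OF sets.empty_sets assms(3) empty_subsetI]
  show ?thesis using assms(1) by (simp add: game_def)
qed

text \<open>Each bound \<mu> dominates the sum by the total \<mu>-measure of the disjoint blocks,
  hence by \<mu> of the whole space; then pass to the infimum over \<mu>. The estimate is
  independent of the mesh and of the partitioned set.\<close>

lemma abs_partition_sum_le_norm_inf:
  assumes "game \<nu>" "lipschitz_bounds M \<nu> \<noteq> {}" "D \<in> msble_partitions M F"
  shows "\<bar>\<Sum>I\<in>D. \<nu> I\<bar> \<le> norm_inf M \<nu>"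
  unfolding norm_inf_def
proof (rule cInf_greatest)
  \<comment> \<open>A lower bound of a set of reals lies below its \<open>Inf\<close> only if the
    set is nonempty; this is where the existence of a Lipschitz bound enters.\<close>
  show "{measure \<mu> (space M) |\<mu>. \<mu> \<in> lipschitz_bounds M \<nu>} \<noteq> {}"
    using assms(2) by blast
next
  fix x assume "x \<in> {measure \<mu> (space M) |\<mu>. \<mu> \<in> lipschitz_bounds M \<nu>}"
  then obtain \<mu> where \<mu>: "\<mu> \<in> lipschitz_bounds M \<nu>" and x: "x = measure \<mu> (space M)" by blast
  then have s: "sets \<mu> = sets M" and "finite_measure \<mu>"
    by (auto simp: lipschitz_bounds_def NA_plus_def)
  interpret finite_measure \<mu> by fact
  have D: "finite D" "D \<subseteq> sets M" "disjoint D"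
    using assms(3) by (auto simp: msble_partitions_def partition_on_def)
  have "\<bar>\<Sum>I\<in>D. \<nu> I\<bar> \<le> (\<Sum>I\<in>D. \<bar>\<nu> I\<bar>)" by (rule sum_abs)
  also have "\<dots> \<le> (\<Sum>I\<in>D. measure \<mu> I)"
    using abs_le_lipschitz_bound[OF assms(1) \<mu>] D(2) by (intro sum_mono) blast
  also have "\<dots> = measure \<mu> (\<Union>D)"
    using D s finite_measure_finite_Union[of D "\<lambda>I. I"]
    by (simp add: disjoint_family_on_def disjoint_def)
  also have "\<dots> \<le> x"
    using bounded_measure[of "\<Union>D"] sets_eq_imp_space_eq[OF s] x by simp
  finally show "\<bar>\<Sum>I\<in>D. \<nu> I\<bar> \<le> x" .
qed

text \<open>Completeness of the reals gives a limit along one sequence of ever finer partitions, and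
  the Cauchy condition compares every other fine partition with that sequence.\<close>

lemma has_BC_integral_Cauchy:
  assumes Cauchy: "\<And>\<epsilon>. \<epsilon> > 0 \<Longrightarrow> \<exists>\<delta>>0. \<forall>D\<in>msble_partitions M E. \<forall>D'\<in>msble_partitions M E.
    mesh \<rho> D < \<delta> \<longrightarrow> mesh \<rho> D' < \<delta> \<longrightarrow> \<bar>(\<Sum>I\<in>D. \<nu> I) - (\<Sum>I\<in>D'. \<nu> I)\<bar> < \<epsilon>"
  shows "\<exists>L. has_BC_integral M \<rho> \<nu> E L"
proof (cases "\<forall>\<delta>>0. \<exists>D\<in>msble_partitions M E. mesh \<rho> D < \<delta>")
  \<comment> \<open>If no partition has mesh below some positive \<delta>, this \<delta> satisfies
    the limit condition vacuously, for any \<open>L\<close>.\<close>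
  case False
  then show ?thesis unfolding has_BC_integral_def by blast
next
  case True
  have "\<forall>n. \<exists>D. D \<in> msble_partitions M E \<and> mesh \<rho> D < inverse (real (Suc n))"
  proof
    fix n
    have "inverse (real (Suc n)) > 0" by simp
    with True show "\<exists>D. D \<in> msble_partitions M E \<and> mesh \<rho> D < inverse (real (Suc n))"
      by blast
  qed
  from choice[OF this] obtain D
    where "\<forall>n. D n \<in> msble_partitions M E \<and> mesh \<rho> (D n) < inverse (real (Suc n))" ..
  then have D: "D n \<in> msble_partitions M E" "mesh \<rho> (D n) < inverse (real (Suc n))" for n
    by simp_all
  have small: "\<exists>N. \<forall>n\<ge>N. mesh \<rho> (D n) < \<delta>" if "\<delta> > 0" for \<delta>
  proof -
    from reals_Archimedean[OF that] obtain N where N: "inverse (real (Suc N)) < \<delta>" ..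
    have "mesh \<rho> (D n) < \<delta>" if "n \<ge> N" for n
    proof -
      have "inverse (real (Suc n)) \<le> inverse (real (Suc N))"
        using that by (intro le_imp_inverse_le) auto
      then show ?thesis using D(2)[of n] N by linarith
    qed
    then show ?thesis by blast
  qed
  define s where "s n = (\<Sum>I\<in>D n. \<nu> I)" for n
  have "Cauchy s"
  proof (rule metric_CauchyI)
    fix \<epsilon> :: real assume "\<epsilon> > 0"
    from Cauchy[OF this] obtain \<delta> where "\<delta> > 0"
      and \<delta>: "\<forall>D\<in>msble_partitions M E. \<forall>D'\<in>msble_partitions M E.
        mesh \<rho> D < \<delta> \<longrightarrow> mesh \<rho> D' < \<delta> \<longrightarrow> \<bar>(\<Sum>I\<in>D. \<nu> I) - (\<Sum>I\<in>D'. \<nu> I)\<bar> < \<epsilon>"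
      by blast
    from small[OF \<open>\<delta> > 0\<close>] obtain N where "\<forall>n\<ge>N. mesh \<rho> (D n) < \<delta>" ..
    then have "\<forall>m\<ge>N. \<forall>n\<ge>N. dist (s m) (s n) < \<epsilon>"
      using \<delta> D(1) by (simp add: dist_real_def s_def)
    then show "\<exists>N. \<forall>m\<ge>N. \<forall>n\<ge>N. dist (s m) (s n) < \<epsilon>" ..
  qed
  then obtain L where L: "s \<longlonglongrightarrow> L" by (auto simp: Cauchy_convergent_iff convergent_def)
  have "has_BC_integral M \<rho> \<nu> E L"
    unfolding has_BC_integral_def
  proof (intro allI impI)
    fix \<epsilon> :: real assume "\<epsilon> > 0"
    then have "\<epsilon> / 2 > 0" by simp
    from Cauchy[OF this] obtain \<delta> where "\<delta> > 0"
      and \<delta>: "\<forall>D\<in>msble_partitions M E. \<forall>D'\<in>msble_partitions M E.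
        mesh \<rho> D < \<delta> \<longrightarrow> mesh \<rho> D' < \<delta> \<longrightarrow> \<bar>(\<Sum>I\<in>D. \<nu> I) - (\<Sum>I\<in>D'. \<nu> I)\<bar> < \<epsilon> / 2"
      by blast
    from small[OF \<open>\<delta> > 0\<close>] obtain N where N: "\<forall>n\<ge>N. mesh \<rho> (D n) < \<delta>" ..
    \<comment> \<open>Letting \<open>n\<close> tend to infinity weakens the strict Cauchy estimate
      to a non-strict one; starting from half of \<epsilon> restores strictness.\<close>
    have "\<bar>(\<Sum>I\<in>D'. \<nu> I) - L\<bar> \<le> \<epsilon> / 2" if "D' \<in> msble_partitions M E" "mesh \<rho> D' < \<delta>" for D'
    proof (rule LIMSEQ_le_const2)
      show "(\<lambda>n. \<bar>(\<Sum>I\<in>D'. \<nu> I) - s n\<bar>) \<longlonglongrightarrow> \<bar>(\<Sum>I\<in>D'. \<nu> I) - L\<bar>"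
        by (intro tendsto_intros L)
      have "\<forall>n\<ge>N. \<bar>(\<Sum>I\<in>D'. \<nu> I) - s n\<bar> \<le> \<epsilon> / 2"
        using \<delta> N D(1) that by (simp add: s_def less_imp_le)
      then show "\<exists>N. \<forall>n\<ge>N. \<bar>(\<Sum>I\<in>D'. \<nu> I) - s n\<bar> \<le> \<epsilon> / 2" ..
    qed
    moreover have "\<epsilon> / 2 < \<epsilon>" using \<open>\<epsilon> > 0\<close> by simp
    ultimately have "\<bar>(\<Sum>I\<in>D'. \<nu> I) - L\<bar> < \<epsilon>"
      if "D' \<in> msble_partitions M E" "mesh \<rho> D' < \<delta>" for D'
      using that by (meson le_less_trans)
    with \<open>\<delta> > 0\<close>
    show "\<exists>\<delta>>0. \<forall>D\<in>msble_partitions M E. mesh \<rho> D < \<delta> \<longrightarrow> \<bar>(\<Sum>I\<in>D. \<nu> I) - L\<bar> < \<epsilon>"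
      by blast
  qed
  then show ?thesis ..
qed

text \<open>All the games share \<rho>, so for each \<epsilon> one index \<open>k\<close> with a
  small norm distance suffices, and the \<delta> of that single \<open>\<nu>s k\<close> serves
  \<nu>.\<close>

lemma BC_integrable_wrt_norm_inf_limit:
  assumes int: "\<And>k. BC_integrable_wrt M \<rho> (\<nu>s k)"
    and game: "\<And>k. game (\<nu>s k)" "game \<nu>"
    and bounds: "\<And>k. lipschitz_bounds M (\<nu>s k) \<noteq> {}" "lipschitz_bounds M \<nu> \<noteq> {}"
    and lim: "(\<lambda>k. norm_inf M (\<lambda>A. \<nu>s k A - \<nu> A)) \<longlonglongrightarrow> 0"
  shows "BC_integrable_wrt M \<rho> \<nu>"
  unfolding BC_integrable_wrt_def
proof (intro ballI has_BC_integral_Cauchy)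
  fix E and \<epsilon> :: real assume E: "E \<in> sets M" and "\<epsilon> > 0"
  then have "\<forall>\<^sub>F k in sequentially. norm_inf M (\<lambda>A. \<nu>s k A - \<nu> A) < \<epsilon> / 4"
    by (intro order_tendstoD(2)[OF lim]) simp
  then obtain k where k: "norm_inf M (\<lambda>A. \<nu>s k A - \<nu> A) < \<epsilon> / 4"
    by (auto simp: eventually_sequentially)
  have close: "\<bar>(\<Sum>I\<in>D. \<nu>s k I) - (\<Sum>I\<in>D. \<nu> I)\<bar> < \<epsilon> / 4" if "D \<in> msble_partitions M E" for D
  proof -
    have "game (\<lambda>A. \<nu>s k A - \<nu> A)" using game by (simp add: game_def)
    from abs_partition_sum_le_norm_inf[OF this lipschitz_bounds_diff_nonempty[OF bounds] that] k
    show ?thesis by (simp add: sum_subtractf)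
  qed
  obtain L where "has_BC_integral M \<rho> (\<nu>s k) E L"
    using int E by (auto simp: BC_integrable_wrt_def)
  moreover have "\<epsilon> / 4 > 0" using \<open>\<epsilon> > 0\<close> by simp
  ultimately obtain \<delta> where "\<delta> > 0"
    and \<delta>: "\<And>D. D \<in> msble_partitions M E \<Longrightarrow> mesh \<rho> D < \<delta> \<Longrightarrow> \<bar>(\<Sum>I\<in>D. \<nu>s k I) - L\<bar> < \<epsilon> / 4"
    unfolding has_BC_integral_def by blast
  \<comment> \<open>Four errors of \<epsilon>/4: from \<nu> to \<open>\<nu>s k\<close> on
    \<open>D\<close>, from there to \<open>L\<close>, from \<open>L\<close> to
    \<open>\<nu>s k\<close> on \<open>D'\<close>, and back to \<nu>.\<close>
  have "\<bar>(\<Sum>I\<in>D. \<nu> I) - (\<Sum>I\<in>D'. \<nu> I)\<bar> < \<epsilon>"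
    if "D \<in> msble_partitions M E" "D' \<in> msble_partitions M E" "mesh \<rho> D < \<delta>" "mesh \<rho> D' < \<delta>" for D D'
    using close[OF that(1)] close[OF that(2)] \<delta>[OF that(1,3)] \<delta>[OF that(2,4)] by linarith
  with \<open>\<delta> > 0\<close> show "\<exists>\<delta>>0. \<forall>D\<in>msble_partitions M E. \<forall>D'\<in>msble_partitions M E.
      mesh \<rho> D < \<delta> \<longrightarrow> mesh \<rho> D' < \<delta> \<longrightarrow> \<bar>(\<Sum>I\<in>D. \<nu> I) - (\<Sum>I\<in>D'. \<nu> I)\<bar> < \<epsilon>"
    by blast
qed

theorem theorem4p2:
  fixes M :: "'a measure"
    and \<nu>s :: "nat \<Rightarrow> 'a set \<Rightarrow> real"
    and \<nu> :: "'a set \<Rightarrow> real"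
  assumes "standard_borel_space M"
    and "\<And>k. \<nu>s k \<in> Q M"
    and "uniformly_BC_integrable M \<nu>s"
    and "\<nu> \<in> AC_inf M"
    and "(\<lambda>k. norm_inf M (\<lambda>A. \<nu>s k A - \<nu> A)) \<longlonglongrightarrow> 0"
  shows "\<nu> \<in> Q M"
proof -
  obtain \<rho> where \<rho>: "\<rho> \<in> NA_plus M"
    and unif: "\<forall>F\<in>sets M. \<forall>\<epsilon>>0. \<exists>\<delta>>0. \<forall>D\<in>msble_partitions M F. mesh \<rho> D < \<delta> \<longrightarrow>
      (\<forall>k. \<bar>(\<Sum>I\<in>D. \<nu>s k I) - BC_integral M \<rho> (\<nu>s k) F\<bar> < \<epsilon>)"
    using assms(3) unfolding uniformly_BC_integrable_def by blast
  \<comment> \<open>For fixed \<open>k\<close> the uniform estimate is itself the limit condition at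
    the number \<open>BC_integral M \<rho> (\<nu>s k) F\<close>, whatever its \<open>THE\<close>
    denotes. Integrability with respect to the common \<rho> is thus read off directly.\<close>
  have "has_BC_integral M \<rho> (\<nu>s k) F (BC_integral M \<rho> (\<nu>s k) F)" if "F \<in> sets M" for k F
    using unif that unfolding has_BC_integral_def by meson
  then have int: "BC_integrable_wrt M \<rho> (\<nu>s k)" for k
    unfolding BC_integrable_wrt_def by blast
  have s: "game (\<nu>s k)" "lipschitz_bounds M (\<nu>s k) \<noteq> {}" for k
    using assms(2)[of k] by (auto simp: Q_def BC_def AC_inf_def)
  have l: "game \<nu>" "lipschitz_bounds M \<nu> \<noteq> {}"
    using assms(4) by (auto simp: AC_inf_def BV_def)
  have "BC_integrable_wrt M \<rho> \<nu>"
    by (rule BC_integrable_wrt_norm_inf_limit[OF int s(1) l(1) s(2) l(2) assms(5)])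
  with \<rho> l(1) assms(4) show ?thesis by (auto simp: Q_def BC_def)
qed

end
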